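(* Let $I=\{1,\dots,m\}$, let $a\in\mathcal O_m$, and let $\mathfrak C_a$ be the algebra of $m\times m\times m$ cubic matrices over the field $\mathbb R$ of real numbers with multiplication $*_a$. For a cubic matrix $A=(a_{ijk})\in\mathfrak C_a$ let $\mathbb B$ be its accompanying $m\times m$ matrix. (i) If $a\in\mathcal O_m$ is a right-symmetric (resp. left-symmetric) operation, then a cubic matrix $A$ is a left (resp. right) zero divisor if and only if $\det\mathbb B=0$. (ii) If $a\in\mathcal O_m$ is a left-symmetric (resp. right-symmetric) operation, then any cubic matrix $A$ is a left (resp. right) zero divisor.
   Context: Here $m=1,2,\dots$, and $\mathcal O_m$ denotes the set of all associative binary operations $a\colon I\times I\to I$. The right-symmetric operation is $a(i,j)=j$ for all $i,j\in I$; the left-symmetric operation is $a(i,j)=i$ for all $i,j\in I$. $\mathfrak C$ is the $m^3$-dimensional $\mathbb R$-vector space of cubic matrices $A=(a_{ijk})_{i,j,k=1}^m$ (entrywise addition and scalar multiplication), with standard basis $E_{ijk}$, $i,j,k\in I$ (the $(i,j,k)$ entry of $E_{ijk}$ is $1$ and all others are $0$). For $a\in\mathcal O_m$, the multiplication $*_a$ is the bilinear extension of $E_{ijk}*_aE_{lnr}=\delta_{kl}E_{i\,a(j,n)\,r}$, where $\delta_{kl}$ is the Kronecker symbol; equivalently $(A*_aB)_{ijr}=\sum_{l,n:\,a(l,n)=j}\sum_{k}a_{ilk}b_{knr}$ for $A=(a_{ijk})$, $B=(b_{ijk})$. $\mathfrak C_a=(\mathfrak C,*_a)$. An element $A\in\mathfrak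 C_a$ is called a left (resp. right) zero divisor if there exists a nonzero $X\in\mathfrak C_a$ such that $A*_aX=0$ (resp. $X*_aA=0$). The accompanying matrix of $A=(a_{ijk})$ is the square matrix $\mathbb B=(A_{ik})_{i,k=1}^m$ with $A_{ik}=\sum_{j=1}^m a_{ijk}$.
   Formalization: Part (ii) is stated only for m ≥ 2: for m = 1 the only operation is both left- and right-symmetric, the algebra is ℝ, and A = (1) is not a zero divisor, so (ii) fails there. *)

theory Defs
  imports "HOL-Analysis.Analysis"
begin

text \<open>
  The index set \<open>I\<close> is the finite type \<open>'m\<close>, so \<open>m = CARD('m)\<close> ranges over all positive integers.
  The entry \<open>a\<^sub>i\<^sub>j\<^sub>k\<close> of a cubic matrix \<open>A\<close> is \<open>A $ i $ j $ k\<close>.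
\<close>

type_synonym 'm cubic = "real ^ 'm ^ 'm ^ 'm"

definition assoc_ops :: "('m \<Rightarrow> 'm \<Rightarrow> 'm) set" where
  "assoc_ops = {a. semigroup a}"

definition right_symmetric :: "('m \<Rightarrow> 'm \<Rightarrow> 'm) \<Rightarrow> bool" where
  "right_symmetric a \<longleftrightarrow> (\<forall>i j. a i j = j)"

definition left_symmetric :: "('m \<Rightarrow> 'm \<Rightarrow> 'm) \<Rightarrow> bool" where
  "left_symmetric a \<longleftrightarrow> (\<forall>i j. a i j = i)"

definition cubic_unit :: "'m::finite \<Rightarrow> 'm \<Rightarrow> 'm \<Rightarrow> 'm cubic" where
  "cubic_unit i j k = axis i (axis j (axis k 1))"

text \<open>
  The bilinear extension of the rule
  \<open>E\<^sub>i\<^sub>j\<^sub>k *\<^sub>a E\<^sub>l\<^sub>n\<^sub>r = \<delta>\<^sub>k\<^sub>l E\<^sub>i\<^sub>a\<^sub>(\<^sub>j\<^sub>,\<^sub>n\<^sub>)\<^sub>r\<close>, with both factors expanded in the standard basis.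
\<close>

definition cubic_mult ::
    "('m::finite \<Rightarrow> 'm \<Rightarrow> 'm) \<Rightarrow> 'm cubic \<Rightarrow> 'm cubic \<Rightarrow> 'm cubic" where
  "cubic_mult a A B =
     (\<Sum>i\<in>UNIV. \<Sum>j\<in>UNIV. \<Sum>k\<in>UNIV. \<Sum>l\<in>UNIV. \<Sum>n\<in>UNIV. \<Sum>r\<in>UNIV.
        (A $ i $ j $ k * B $ l $ n $ r) *\<^sub>R
        (if k = l then cubic_unit i (a j n) r else 0))"

definition left_zero_divisor :: "('m::finite \<Rightarrow> 'm \<Rightarrow> 'm) \<Rightarrow> 'm cubic \<Rightarrow> bool" where
  "left_zero_divisor a A \<longleftrightarrow> (\<exists>X. X \<noteq> 0 \<and> cubic_mult a A X = 0)"

definition right_zero_divisor :: "('m::finite \<Rightarrow> 'm \<Rightarrow> 'm) \<Rightarrow> 'm cubic \<Rightarrow> bool" where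
  "right_zero_divisor a A \<longleftrightarrow> (\<exists>X. X \<noteq> 0 \<and> cubic_mult a X A = 0)"

definition accompanying :: "'m::finite cubic \<Rightarrow> real ^ 'm ^ 'm" where
  "accompanying A = (\<chi> i k. \<Sum>j\<in>UNIV. A $ i $ j $ k)"

lemma cubic_unit_nth:
  "cubic_unit i j k $ i' $ j' $ k' = (if i' = i \<and> j' = j \<and> k' = k then 1 else 0)"
  by (auto simp: cubic_unit_def axis_def)

lemma cubic_mult_nth:
  "cubic_mult a A B $ i $ j $ r =
     (\<Sum>(l, n) \<in> {(l, n). a l n = j}. \<Sum>k\<in>UNIV. A $ i $ l $ k * B $ k $ n $ r)"
proof -
  have pull: "(\<Sum>x\<in>S. if P then f x else 0) = (if P then sum f S else 0)"
    for P and f :: "'m \<Rightarrow> real" and S by simp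
  have "cubic_mult a A B $ i $ j $ r =
     (\<Sum>i'\<in>UNIV. \<Sum>l\<in>UNIV. \<Sum>k\<in>UNIV. \<Sum>k'\<in>UNIV. \<Sum>n\<in>UNIV. \<Sum>r'\<in>UNIV.
       if i' = i then if k' = k then if r' = r then if a l n = j
         then A $ i $ l $ k * B $ k $ n $ r else 0 else 0 else 0 else 0)"
    unfolding cubic_mult_def sum_component vector_scaleR_component
    by (intro sum.cong refl) (auto simp: cubic_unit_nth)
  also have "\<dots> = (\<Sum>l\<in>UNIV. \<Sum>k\<in>UNIV. \<Sum>n\<in>UNIV.
       if a l n = j then A $ i $ l $ k * B $ k $ n $ r else 0)"
    by (simp add: pull)
  also have "\<dots> = (\<Sum>l\<in>UNIV. \<Sum>n\<in>UNIV. \<Sum>k\<in>UNIV.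
       if a l n = j then A $ i $ l $ k * B $ k $ n $ r else 0)"
    by (intro sum.cong refl sum.swap)
  also have "\<dots> = (\<Sum>(l, n)\<in>UNIV.
       if a l n = j then \<Sum>k\<in>UNIV. A $ i $ l $ k * B $ k $ n $ r else 0)"
    by (simp add: pull sum.cartesian_product)
  also have "\<dots> = (\<Sum>(l, n) \<in> {(l, n). a l n = j}. \<Sum>k\<in>UNIV. A $ i $ l $ k * B $ k $ n $ r)"
    by (rule sum.mono_neutral_cong_right) (auto split: if_splits)
  finally show ?thesis .
qed

end

theory Submission imports Defs begin

text \<open>
  If \<open>a\<close> is one of the two symmetric operations, one factor of a product \<open>A *\<^sub>a B\<close> enters
  only through its accompanying matrix: for right-symmetric \<open>a\<close> every column \<open>B\<^sub>\<sqdot>\<^sub>j\<^sub>r\<close> is multiplied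
  from the left by the accompanying matrix of \<open>A\<close> (lemma \<open>cubic_mult_right_symmetric\<close>), and for
  left-symmetric \<open>a\<close> every row \<open>A\<^sub>i\<^sub>j\<^sub>\<sqdot>\<close> is multiplied from the right by the accompanying matrix
  of \<open>B\<close> (lemma \<open>cubic_mult_left_symmetric\<close>).

  The first part then is linear algebra: the square matrix annihilates a nonzero cubic matrix
  exactly if it annihilates a nonzero vector, as the cubic matrix falls apart into columns (or rows)
  on which the square matrix acts separately.

  For the second part, the unknown \<open>X\<close> is the factor that enters only through its accompanying
  matrix. With at least two indices, the middle index can be summed out to zero in a nonzero \<open>X\<close>,
  and such an \<open>X\<close> annihilates every \<open>A\<close>.
\<close>

lemma det_eq_0_iff_kernel:
  fixes M :: "real ^ 'n ^ 'n"
  shows "det M = 0 \<longleftrightarrow> (\<exists>x. x \<noteq> 0 \<and> M *v x = 0)"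
proof -
  have "det M \<noteq> 0 \<longleftrightarrow> (\<exists>N. N ** M = mat 1)"
    by (simp add: invertible_det_nz[symmetric] invertible_left_inverse)
  then show ?thesis
    unfolding matrix_left_invertible_ker by blast
qed

lemma det_eq_0_iff_left_kernel:
  fixes M :: "real ^ 'n ^ 'n"
  shows "det M = 0 \<longleftrightarrow> (\<exists>x. x \<noteq> 0 \<and> x v* M = 0)"
  using det_eq_0_iff_kernel[of "transpose M"] by (simp add: det_transpose)

text \<open>
  The pairs \<open>(l, n)\<close> with \<open>a l n = j\<close> are those with \<open>n = j\<close>, so the middle index \<open>l\<close> of the
  left factor is summed freely.
\<close>

lemma cubic_mult_right_symmetric:
  assumes "right_symmetric a"
  shows "cubic_mult a A B $ i $ j $ r = (accompanying A *v (\<chi> k. B $ k $ j $ r)) $ i"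
proof -
  have "{(l, n). a l n = j} = UNIV \<times> {j}"
    using assms by (auto simp: right_symmetric_def)
  then have "cubic_mult a A B $ i $ j $ r =
      (\<Sum>l\<in>UNIV. \<Sum>k\<in>UNIV. A $ i $ l $ k * B $ k $ j $ r)"
    by (simp add: cubic_mult_nth sum.cartesian_product[symmetric])
  also have "\<dots> = (\<Sum>k\<in>UNIV. \<Sum>l\<in>UNIV. A $ i $ l $ k * B $ k $ j $ r)"
    by (rule sum.swap)
  finally show ?thesis
    by (simp add: matrix_vector_mult_def accompanying_def sum_distrib_right)
qed

lemma cubic_mult_left_symmetric:
  assumes "left_symmetric a"
  shows "cubic_mult a A B $ i $ j = A $ i $ j v* accompanying B"
  unfolding vec_eq_iff
proof
  fix r
  have "{(l, n). a l n = j} = {j} \<times> UNIV"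
    using assms by (auto simp: left_symmetric_def)
  then have "cubic_mult a A B $ i $ j $ r =
      (\<Sum>n\<in>UNIV. \<Sum>k\<in>UNIV. A $ i $ j $ k * B $ k $ n $ r)"
    by (simp add: cubic_mult_nth sum.cartesian_product[symmetric])
  also have "\<dots> = (\<Sum>k\<in>UNIV. \<Sum>n\<in>UNIV. A $ i $ j $ k * B $ k $ n $ r)"
    by (rule sum.swap)
  finally show "cubic_mult a A B $ i $ j $ r = (A $ i $ j v* accompanying B) $ r"
    by (simp add: vector_matrix_mult_def accompanying_def sum_distrib_left mult.commute)
qed

lemma left_zero_divisor_right_symmetric:
  assumes "right_symmetric a"
  shows "left_zero_divisor a A \<longleftrightarrow> det (accompanying A) = 0"
proof
  assume "left_zero_divisor a A"
  then obtain X where "X \<noteq> 0" and X0: "cubic_mult a A X = 0"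
    by (auto simp: left_zero_divisor_def)
  then obtain k j r where "X $ k $ j $ r \<noteq> 0"
    by (auto simp: vec_eq_iff)
  then have "(\<chi> k. X $ k $ j $ r) \<noteq> 0"
    by (auto simp: vec_eq_iff)
  moreover have "accompanying A *v (\<chi> k. X $ k $ j $ r) = 0"
    unfolding vec_eq_iff
    by (simp add: cubic_mult_right_symmetric[OF assms, symmetric] X0)
  ultimately show "det (accompanying A) = 0"
    unfolding det_eq_0_iff_kernel by blast
next
  assume "det (accompanying A) = 0"
  then obtain x where "x \<noteq> 0" and x: "accompanying A *v x = 0"
    unfolding det_eq_0_iff_kernel by blast
  define X :: "'a cubic" where "X = (\<chi> k j r. x $ k)"
  have "X \<noteq> 0"
    using \<open>x \<noteq> 0\<close> by (auto simp: X_def vec_eq_iff)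
  moreover have "cubic_mult a A X = 0"
    by (simp add: vec_eq_iff cubic_mult_right_symmetric[OF assms] X_def x)
  ultimately show "left_zero_divisor a A"
    by (auto simp: left_zero_divisor_def)
qed

lemma right_zero_divisor_left_symmetric:
  assumes "left_symmetric a"
  shows "right_zero_divisor a A \<longleftrightarrow> det (accompanying A) = 0"
proof
  assume "right_zero_divisor a A"
  then obtain X where "X \<noteq> 0" and X0: "cubic_mult a X A = 0"
    by (auto simp: right_zero_divisor_def)
  then obtain i j where "X $ i $ j \<noteq> 0"
    by (auto simp: vec_eq_iff)
  moreover have "X $ i $ j v* accompanying A = 0"
    by (simp add: cubic_mult_left_symmetric[OF assms, symmetric] X0)
  ultimately show "det (accompanying A) = 0"
    unfolding det_eq_0_iff_left_kernel by blast
next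
  assume "det (accompanying A) = 0"
  then obtain x where "x \<noteq> 0" and x: "x v* accompanying A = 0"
    unfolding det_eq_0_iff_left_kernel by blast
  define X :: "'a cubic" where "X = (\<chi> i j. x)"
  have "X \<noteq> 0"
    using \<open>x \<noteq> 0\<close> by (auto simp: X_def vec_eq_iff)
  moreover have "cubic_mult a X A $ i $ j = 0" for i j
    by (simp add: cubic_mult_left_symmetric[OF assms] X_def x)
  then have "cubic_mult a X A = 0"
    by (simp add: vec_eq_iff)
  ultimately show "right_zero_divisor a A"
    by (auto simp: right_zero_divisor_def)
qed

text \<open>
  Two distinct middle indices leave room for cancellation in the sum over the middle index; with
  a single index, a cubic matrix is determined by its accompanying matrix.
\<close>

lemma exists_nonzero_accompanying_eq_0:
  assumes "CARD('m::finite) \<ge> 2"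
  shows "\<exists>X :: 'm cubic. X \<noteq> 0 \<and> accompanying X = 0"
proof -
  obtain p q :: 'm where "p \<noteq> q"
    using assms by (meson card_2_iff' ex_card)
  define X :: "'m cubic" where "X = cubic_unit p p p - cubic_unit p q p"
  have "X $ p $ p $ p = 1"
    using \<open>p \<noteq> q\<close> by (simp add: X_def cubic_unit_nth)
  then have "X \<noteq> 0"
    by auto
  moreover have "accompanying (cubic_unit p j p) = axis p (axis p 1)" for j :: 'm
    by (auto simp: vec_eq_iff accompanying_def cubic_unit_nth axis_def)
  then have "accompanying X = 0"
    by (simp add: X_def vec_eq_iff accompanying_def sum_subtractf)
  ultimately show ?thesis
    by blast
qed

lemma left_zero_divisor_left_symmetric:
  fixes a :: "'m::finite \<Rightarrow> 'm \<Rightarrow> 'm"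
  assumes "left_symmetric a" and "CARD('m) \<ge> 2"
  shows "left_zero_divisor a A"
proof -
  obtain X :: "'m cubic" where "X \<noteq> 0" and X: "accompanying X = 0"
    using exists_nonzero_accompanying_eq_0[OF assms(2)] by blast
  have "cubic_mult a A X $ i $ j = 0" for i j
    by (simp add: cubic_mult_left_symmetric[OF assms(1)] X)
  then have "cubic_mult a A X = 0"
    by (simp add: vec_eq_iff)
  with \<open>X \<noteq> 0\<close> show ?thesis
    by (auto simp: left_zero_divisor_def)
qed

lemma right_zero_divisor_right_symmetric:
  fixes a :: "'m::finite \<Rightarrow> 'm \<Rightarrow> 'm"
  assumes "right_symmetric a" and "CARD('m) \<ge> 2"
  shows "right_zero_divisor a A"
proof -
  obtain X :: "'m cubic" where "X \<noteq> 0" and X: "accompanying X = 0"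
    using exists_nonzero_accompanying_eq_0[OF assms(2)] by blast
  have "cubic_mult a X A = 0"
    by (simp add: vec_eq_iff cubic_mult_right_symmetric[OF assms(1)] X)
  with \<open>X \<noteq> 0\<close> show ?thesis
    by (auto simp: right_zero_divisor_def)
qed

theorem proposition6p2:
  fixes a :: "'m::finite \<Rightarrow> 'm \<Rightarrow> 'm"
  assumes "a \<in> assoc_ops"
  shows
    "(right_symmetric a \<longrightarrow>
        (\<forall>A. left_zero_divisor a A \<longleftrightarrow> det (accompanying A) = 0)) \<and>
     (left_symmetric a \<longrightarrow>
        (\<forall>A. right_zero_divisor a A \<longleftrightarrow> det (accompanying A) = 0)) \<and>
     (CARD('m) \<ge> 2 \<longrightarrow>
        (left_symmetric a \<longrightarrow> (\<forall>A. left_zero_divisor a A)) \<and>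
        (right_symmetric a \<longrightarrow> (\<forall>A. right_zero_divisor a A)))"
  by (simp add: left_zero_divisor_right_symmetric right_zero_divisor_left_symmetric
      left_zero_divisor_left_symmetric right_zero_divisor_right_symmetric)

end
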